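(* Let $J\subset(0,\infty)$ be an interval, let $a_1,\dots,a_n\in J$ and let $t_1,\dots,t_n$ be non-negative real numbers with $\sum_{i=1}^n t_i=1$. Put $A:=\sum_{i=1}^n t_ia_i$. (i) If $f:J\to(0,\infty)$ is a differentiable log-convex function, then $$L_n\, f(A)\le \sum_{i=1}^n t_i f(a_i)\le R_n\, f(A),$$ where $$L_n:=\sum_{i=1}^n t_i\exp\left(\frac{f'(A)(a_i-A)}{f(A)}\right),\qquad R_n:=\sum_{i=1}^n t_i\exp\left(\frac{f'(a_i)(a_i-A)}{f(a_i)}\right).$$ (ii) If $f:J\to(0,\infty)$ is a differentiable geometrically convex function, then $$\hat L_n\, f(A)\le \sum_{i=1}^n t_i f(a_i)\le \hat R_n\, f(A),$$ where $$\hat L_n:=\sum_{i=1}^n t_i\left(\frac{a_i}{A}\right)^{\frac{A f'(A)}{f(A)}},\qquad \hat R_n:=\sum_{i=1}^n t_i\left(\frac{a_i}{A}\right)^{\frac{a_i f'(a_i)}{f(a_i)}}.$$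
   Context: A function $f:J\to(0,\infty)$ is log-convex if $f((1-\lambda)a+\lambda b)\le f(a)^{1-\lambda}f(b)^{\lambda}$ for all $a,b\in J$, $0\le\lambda\le1$; it is geometrically convex if $f(a^{1-\lambda}b^{\lambda})\le f(a)^{1-\lambda}f(b)^{\lambda}$ for all $a,b\in J$, $0\le\lambda\le1$. *)

theory Defs
  imports "HOL-Analysis.Analysis"
begin

(* Both notions are meant for functions that are positive on J (and, for geometric
   convexity, for J contained in the positive reals), where powr is the usual power. *)

definition log_convex_on :: "real set \<Rightarrow> (real \<Rightarrow> real) \<Rightarrow> bool" where
  "log_convex_on J f \<longleftrightarrow>
     (\<forall>a\<in>J. \<forall>b\<in>J. \<forall>s\<in>{0..1}.
        f ((1 - s) * a + s * b) \<le> f a powr (1 - s) * f b powr s)"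

definition geometrically_convex_on :: "real set \<Rightarrow> (real \<Rightarrow> real) \<Rightarrow> bool" where
  "geometrically_convex_on J f \<longleftrightarrow>
     (\<forall>a\<in>J. \<forall>b\<in>J. \<forall>s\<in>{0..1}.
        f (a powr (1 - s) * b powr s) \<le> f a powr (1 - s) * f b powr s)"

end

theory Submission
  imports Defs
begin

text \<open>
  Log-convexity bounds \<open>ln \<circ> f\<close> by its chord along the segment from \<open>x\<close> to \<open>y\<close>, geometric convexity
  along the path \<open>x powr (1 - s) * y powr s\<close>. Differentiating at \<open>s = 0\<close> yields the multiplicative
  tangent inequalities \<open>f x * exp (f' x * (y - x) / f x) \<le> f y\<close> and
  \<open>f x * (y / x) powr (x * f' x / f x) \<le> f y\<close>. The lower bounds are the weighted sums of these at
  \<open>(x, y) = (A, a i)\<close>, the upper bounds those at \<open>(x, y) = (a i, A)\<close>.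
\<close>

text \<open>The chord bound says that every difference quotient of \<open>h\<close> at
  \<open>0\<close> with \<open>0 < s \<le> 1\<close> is at most \<open>h 1 - h 0\<close>; the
  one-sided limit \<open>D\<close> inherits this.\<close>

lemma derivative_le_chord_slope:
  fixes h :: "real \<Rightarrow> real"
  assumes deriv: "(h has_real_derivative D) (at 0 within {0..1})"
    and chord: "\<And>s. s \<in> {0..1} \<Longrightarrow> h s \<le> (1 - s) * h 0 + s * h 1"
  shows "D \<le> h 1 - h 0"
proof (rule tendsto_upperbound)
  show "((\<lambda>s. (h s - h 0) / (s - 0)) \<longlongrightarrow> D) (at 0 within {0..1})"
    using deriv by (simp add: has_field_derivative_iff)
  show "\<forall>\<^sub>F s in at 0 within {0..1}. (h s - h 0) / (s - 0) \<le> h 1 - h 0"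
    unfolding eventually_at_filter
  proof (intro always_eventually allI impI)
    fix s :: real
    assume "s \<noteq> 0" and s: "s \<in> {0..1}"
    then have "0 < s"
      by simp
    moreover have "h s - h 0 \<le> (h 1 - h 0) * s"
      using chord[OF s] by (simp add: algebra_simps)
    ultimately show "(h s - h 0) / (s - 0) \<le> h 1 - h 0"
      by (simp add: pos_divide_le_eq)
  qed
  \<comment> \<open>The limit carries the bound over only because \<open>0\<close> is a limit point
    of \<open>{0..1}\<close>.\<close>
  show "at 0 within {0..1} \<noteq> (bot :: real filter)"
    by (simp add: trivial_limit_within islimpt_Icc)
qed

text \<open>Common core of both cases: \<open>p\<close> is a path in \<open>J\<close> from
  \<open>x\<close> to \<open>y\<close> with initial velocity \<open>p'\<close>. Logarithms turn
  \<open>bound\<close> into a chord bound for \<open>ln \<circ> f \<circ> p\<close>, whose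
  derivative at \<open>0\<close> is \<open>f' * p' / f x\<close>; exponentiating the resulting slope
  inequality gives the claim.\<close>

lemma exp_tangent_le:
  fixes f p :: "real \<Rightarrow> real"
  assumes f_deriv: "(f has_real_derivative f') (at x within J)"
    and f_pos: "\<And>z. z \<in> J \<Longrightarrow> 0 < f z"
    and p_in: "p ` {0..1} \<subseteq> J" and p0: "p 0 = x" and p1: "p 1 = y"
    and p_deriv: "(p has_real_derivative p') (at 0 within {0..1})"
    and bound: "\<And>s. s \<in> {0..1} \<Longrightarrow> f (p s) \<le> f x powr (1 - s) * f y powr s"
  shows "f x * exp (f' * p' / f x) \<le> f y"
proof -
  have xJ: "x \<in> J" and yJ: "y \<in> J"
    using p_in p0 p1 by force+
  have fx: "0 < f x" and fy: "0 < f y"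
    using f_pos xJ yJ by auto
  \<comment> \<open>As \<open>p\<close> stays in \<open>J\<close>, the derivative of
    \<open>f\<close> within \<open>J\<close> restricts to the image of \<open>p\<close>, which is
    what the chain rule asks for. This also covers an endpoint \<open>x\<close> of
    \<open>J\<close>.\<close>
  have "((f \<circ> p) has_real_derivative f' * p') (at 0 within {0..1})"
    using f_deriv p_deriv p0 p_in by (blast intro: DERIV_image_chain has_field_derivative_subset)
  then have "((\<lambda>s. ln (f (p s))) has_real_derivative inverse (f (p 0)) * (f' * p')) (at 0 within {0..1})"
    using fx p0 by (intro DERIV_chain2[OF DERIV_ln]) (auto simp: o_def)
  then have "((\<lambda>s. ln (f (p s))) has_real_derivative f' * p' / f x) (at 0 within {0..1})"
    by (simp add: p0 divide_inverse mult.commute)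
  then have "f' * p' / f x \<le> ln (f (p 1)) - ln (f (p 0))"
  proof (rule derivative_le_chord_slope)
    fix s :: real
    assume s: "s \<in> {0..1}"
    then have "0 < f (p s)"
      using f_pos p_in by blast
    then have "ln (f (p s)) \<le> ln (f x powr (1 - s) * f y powr s)"
      using bound[OF s] by (intro ln_mono)
    also have "\<dots> = (1 - s) * ln (f x) + s * ln (f y)"
      using fx fy by (simp add: ln_mult ln_powr)
    finally show "ln (f (p s)) \<le> (1 - s) * ln (f (p 0)) + s * ln (f (p 1))"
      by (simp add: p0 p1)
  qed
  then have "exp (f' * p' / f x) \<le> exp (ln (f y) - ln (f x))"
    by (simp add: p0 p1)
  also have "\<dots> = f y / f x"
    using fx fy by (simp add: exp_diff)
  finally show ?thesis
    using fx by (simp add: field_simps)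
qed

lemma log_convex_tangent_le:
  fixes f :: "real \<Rightarrow> real"
  assumes "is_interval J" and f_pos: "\<And>z. z \<in> J \<Longrightarrow> 0 < f z"
    and f_deriv: "(f has_real_derivative f') (at x within J)"
    and conv: "log_convex_on J f" and x: "x \<in> J" and y: "y \<in> J"
  shows "f x * exp (f' * (y - x) / f x) \<le> f y"
proof (rule exp_tangent_le[OF f_deriv f_pos, where p = "\<lambda>s. (1 - s) * x + s * y"])
  have "convex J"
    using assms(1) by (rule is_interval_convex)
  then show "(\<lambda>s. (1 - s) * x + s * y) ` {0..1} \<subseteq> J"
    using x y by (auto simp: convex_alt)
  show "((\<lambda>s. (1 - s) * x + s * y) has_real_derivative y - x) (at 0 within {0..1})"
    by (auto intro!: derivative_eq_intros)
  show "f ((1 - s) * x + s * y) \<le> f x powr (1 - s) * f y powr s" if "s \<in> {0..1}" for s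
    using conv x y that unfolding log_convex_on_def by blast
qed auto

text \<open>A weighted geometric mean lies between the smaller and the larger of its two
  arguments.\<close>

lemma powr_mult_powr_in_interval:
  fixes x y s :: real
  assumes "is_interval J" "J \<subseteq> {0<..}" "x \<in> J" "y \<in> J" "s \<in> {0..1}"
  shows "x powr (1 - s) * y powr s \<in> J"
proof -
  have pos: "0 < x" "0 < y"
    using assms by auto
  have le: "u \<le> u powr (1 - s) * v powr s \<and> u powr (1 - s) * v powr s \<le> v"
    if "0 < u" "u \<le> v" "s \<in> {0..1}" for u v s :: real
  proof
    \<comment> \<open>Splitting \<open>u\<close> and \<open>v\<close> with the same exponents allows
      a comparison factor by factor.\<close>
    have "u = u powr (1 - s) * u powr s" "v = v powr (1 - s) * v powr s"
      using that by (simp_all flip: powr_add)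
    moreover have "u powr s \<le> v powr s" "u powr (1 - s) \<le> v powr (1 - s)"
      using that by (auto intro: powr_mono2)
    ultimately show "u \<le> u powr (1 - s) * v powr s" "u powr (1 - s) * v powr s \<le> v"
      by (metis mult_left_mono powr_ge_zero, metis mult_right_mono powr_ge_zero)
  qed
  show ?thesis
  proof (cases "x \<le> y")
    case True
    then show ?thesis
      using le[of x y s] pos assms by (meson mem_is_interval_1_I)
  next
    case False
    \<comment> \<open>Exchanging \<open>x\<close> with \<open>y\<close> and \<open>s\<close> with
      \<open>1 - s\<close> leaves the mean unchanged.\<close>
    then have "y \<le> x powr (1 - s) * y powr s" "x powr (1 - s) * y powr s \<le> x"
      using le[of y x "1 - s"] pos assms(5) by (auto simp: mult.commute)
    then show ?thesis
      using assms by (meson mem_is_interval_1_I)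
  qed
qed

text \<open>The path is a straight segment in the coordinate \<open>ln\<close>, so its velocity at
  \<open>0\<close> is \<open>x * (ln y - ln x)\<close>. The logarithm in the exponent is what turns
  the exponential factor into a power of \<open>y / x\<close>.\<close>

lemma geometrically_convex_tangent_le:
  fixes f :: "real \<Rightarrow> real"
  assumes J: "is_interval J" "J \<subseteq> {0<..}" and f_pos: "\<And>z. z \<in> J \<Longrightarrow> 0 < f z"
    and f_deriv: "(f has_real_derivative f') (at x within J)"
    and conv: "geometrically_convex_on J f" and x: "x \<in> J" and y: "y \<in> J"
  shows "f x * (y / x) powr (x * f' / f x) \<le> f y"
proof -
  have pos: "0 < x" "0 < y"
    using J x y by auto
  have "f x * exp (f' * (x * (ln y - ln x)) / f x) \<le> f y"
  proof (rule exp_tangent_le[OF f_deriv f_pos, where p = "\<lambda>s. x powr (1 - s) * y powr s"])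
    show "(\<lambda>s. x powr (1 - s) * y powr s) ` {0..1} \<subseteq> J"
      using powr_mult_powr_in_interval[OF J x y] by auto
    have "(\<lambda>s. x powr (1 - s) * y powr s) = (\<lambda>s. exp ((1 - s) * ln x + s * ln y))"
      using pos by (simp add: powr_def exp_add)
    then show "((\<lambda>s. x powr (1 - s) * y powr s) has_real_derivative x * (ln y - ln x)) (at 0 within {0..1})"
      using pos by (auto intro!: derivative_eq_intros)
    show "f (x powr (1 - s) * y powr s) \<le> f x powr (1 - s) * f y powr s" if "s \<in> {0..1}" for s
      using conv x y that unfolding geometrically_convex_on_def by blast
  qed (use pos in auto)
  moreover have "f' * (x * (ln y - ln x)) / f x = x * f' / f x * ln (y / x)"
    using pos by (simp add: ln_div)
  ultimately show ?thesis
    using pos by (simp add: powr_def)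
qed

theorem corollary2p11:
  fixes J :: "real set" and n :: nat and a t :: "nat \<Rightarrow> real" and A :: real
    and f f' :: "real \<Rightarrow> real"
  assumes J_interval: "is_interval J" and J_pos: "J \<subseteq> {0<..}"
    and a_in: "\<And>i. i \<in> {1..n} \<Longrightarrow> a i \<in> J"
    and t_nonneg: "\<And>i. i \<in> {1..n} \<Longrightarrow> 0 \<le> t i"
    and t_sum: "(\<Sum>i=1..n. t i) = 1"
    and A: "A = (\<Sum>i=1..n. t i * a i)"
    and f_pos: "\<And>x. x \<in> J \<Longrightarrow> 0 < f x"
    and f_deriv: "\<And>x. x \<in> J \<Longrightarrow> (f has_real_derivative f' x) (at x within J)"
  shows "(log_convex_on J f \<longrightarrow>
            (\<Sum>i=1..n. t i * exp (f' A * (a i - A) / f A)) * f A \<le> (\<Sum>i=1..n. t i * f (a i)) \<and>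
            (\<Sum>i=1..n. t i * f (a i)) \<le> (\<Sum>i=1..n. t i * exp (f' (a i) * (a i - A) / f (a i))) * f A)
       \<and> (geometrically_convex_on J f \<longrightarrow>
            (\<Sum>i=1..n. t i * (a i / A) powr (A * f' A / f A)) * f A \<le> (\<Sum>i=1..n. t i * f (a i)) \<and>
            (\<Sum>i=1..n. t i * f (a i)) \<le> (\<Sum>i=1..n. t i * (a i / A) powr (a i * f' (a i) / f (a i))) * f A)"
proof -
  have "convex J"
    using J_interval by (rule is_interval_convex)
  then have AJ: "A \<in> J"
    unfolding A using convex_sum[of "{1..n}" J t a] a_in t_nonneg t_sum by simp
  \<comment> \<open>Both cases reduce to termwise inequalities, with \<open>l\<close> and
    \<open>r\<close> the exponential or power factors of the lower and upper bound.\<close>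
  have sum_le: "(\<Sum>i=1..n. t i * l i) * f A \<le> (\<Sum>i=1..n. t i * f (a i)) \<and>
      (\<Sum>i=1..n. t i * f (a i)) \<le> (\<Sum>i=1..n. t i * r i) * f A"
    if "\<And>i. i \<in> {1..n} \<Longrightarrow> f A * l i \<le> f (a i)" "\<And>i. i \<in> {1..n} \<Longrightarrow> f (a i) \<le> f A * r i"
    for l r :: "nat \<Rightarrow> real"
    unfolding sum_distrib_right mult.assoc
    using that t_nonneg by (intro conjI sum_mono mult_left_mono) (simp_all add: mult.commute)
  have "(\<Sum>i=1..n. t i * exp (f' A * (a i - A) / f A)) * f A \<le> (\<Sum>i=1..n. t i * f (a i)) \<and>
      (\<Sum>i=1..n. t i * f (a i)) \<le> (\<Sum>i=1..n. t i * exp (f' (a i) * (a i - A) / f (a i))) * f A"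
    if conv: "log_convex_on J f"
  proof (rule sum_le)
    fix i
    assume i: "i \<in> {1..n}"
    note tangent = log_convex_tangent_le[OF J_interval f_pos f_deriv conv]
    show "f A * exp (f' A * (a i - A) / f A) \<le> f (a i)"
      using tangent[OF _ AJ AJ a_in[OF i]] by simp
    \<comment> \<open>The tangent inequality from \<open>a i\<close> to \<open>A\<close> has the
      exponent with the opposite sign; multiplying by the reciprocal factor moves it to the side of
      \<open>f A\<close>.\<close>
    have "f (a i) = f (a i) * exp (f' (a i) * (A - a i) / f (a i)) * exp (f' (a i) * (a i - A) / f (a i))"
      by (simp add: mult.assoc flip: exp_add add_divide_distrib distrib_left)
    also have "\<dots> \<le> f A * exp (f' (a i) * (a i - A) / f (a i))"
      using tangent[OF _ a_in[OF i] a_in[OF i] AJ] by (intro mult_right_mono) auto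
    finally show "f (a i) \<le> f A * exp (f' (a i) * (a i - A) / f (a i))" .
  qed
  moreover have "(\<Sum>i=1..n. t i * (a i / A) powr (A * f' A / f A)) * f A \<le> (\<Sum>i=1..n. t i * f (a i)) \<and>
      (\<Sum>i=1..n. t i * f (a i)) \<le> (\<Sum>i=1..n. t i * (a i / A) powr (a i * f' (a i) / f (a i))) * f A"
    if conv: "geometrically_convex_on J f"
  proof (rule sum_le)
    fix i
    assume i: "i \<in> {1..n}"
    have pos: "0 < A" "0 < a i"
      using AJ a_in[OF i] J_pos by auto
    note tangent = geometrically_convex_tangent_le[OF J_interval J_pos f_pos f_deriv conv]
    show "f A * (a i / A) powr (A * f' A / f A) \<le> f (a i)"
      using tangent[OF _ AJ AJ a_in[OF i]] by simp
    let ?e = "a i * f' (a i) / f (a i)"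
    \<comment> \<open>The two bases are reciprocal, so their powers cancel and the factor can again
      be moved to the side of \<open>f A\<close>.\<close>
    have "f (a i) = f (a i) * (A / a i) powr ?e * (a i / A) powr ?e"
      using pos by (simp add: mult.assoc flip: powr_mult)
    also have "\<dots> \<le> f A * (a i / A) powr ?e"
      using tangent[OF _ a_in[OF i] a_in[OF i] AJ] by (intro mult_right_mono) auto
    finally show "f (a i) \<le> f A * (a i / A) powr ?e" .
  qed
  ultimately show ?thesis
    by blast
qed

end
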